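(* Let $\tau_0>0$ and $x=e^{-i\omega\tau_0}$. (a) (Concatenated dephasing sequence.) Let $F_z^{(n)}:[0,2^n\tau_0)\to\{\pm1\}$ be the sign function of the level-$n$ concatenation of the sequence $X\,\mathbb I\,X\,\mathbb I$, as defined in the context, and $\tilde F_z^{(n)}(\omega)=\int_0^{2^n\tau_0}e^{-i\omega t}F_z^{(n)}(t)\,dt$. Then for all $n\ge1$ and $\omega\neq0$, $$\tilde F_z^{(n)}(\omega)=2\omega^{-1}x^{1/2}\sin(\omega\tau_0/2)\prod_{k=1}^nx^{2^{k-2}}\left(2i\sin\left(2^{k-2}\omega\tau_0\right)\right),$$ where $x^a$ means $e^{-ia\omega\tau_0}$, and as $\omega\tau_0\to0$ its leading behavior is $\tilde F_z^{(n)}(\omega)=\tau_0\,i^n\,2^{n(n-1)/2}(\omega\tau_0)^n+\cdots$. (b) (Concatenated universal sequence.) Let $F_x^{(n)}:[0,4^n\tau_0)\to\{\pm1\}$ be the sign function for $\sigma_x$ of the level-$n$ concatenation of the universal sequence $Z\,\mathbb I\,X\,\mathbb I\,Z\,\mathbb I\,X\,\mathbb I$, as defined in the context, and $\tilde F_x^{(n)}(\omega)=\int_0^{4^n\tau_0}e^{-i\omega t}F_x^{(n)}(t)\,dt$. Then for all $n\ge1$, as $\omega\tau_0\to0$, $$\tilde F_x^{(n)}(\omega)=\tau_0\,i^n\,4^{n(n+1)/2}(\omega\tau_0)^n+\cdots,$$ where the ellipsis denotes terms of higher order in $\omega\tau_0$.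
   Context: Pulses are ideal (zero width). The sign functions are $F_\alpha(t)=+1$ if $\sigma_\alpha$ commutes with the control unitary $U_c(t)$ and $-1$ if it anticommutes. Explicitly: (a) $F_z^{(0)}=+1$ on $[0,\tau_0)$, and for $n\ge1$, $F_z^{(n)}(t)=F_z^{(n-1)}(t)$ for $t\in[0,2^{n-1}\tau_0)$ and $F_z^{(n)}(t)=-F_z^{(n-1)}(t-2^{n-1}\tau_0)$ for $t\in[2^{n-1}\tau_0,2^n\tau_0)$ (so $F_z^{(1)}=(+-)$, $F_z^{(2)}=(+--+)$, etc.). (b) $F_x^{(0)}=+1$ on $[0,\tau_0)$, and for $n\ge1$ and $j=0,1,2,3$, $F_x^{(n)}(t)=\epsilon_jF_x^{(n-1)}(t-j4^{n-1}\tau_0)$ for $t\in[j4^{n-1}\tau_0,(j+1)4^{n-1}\tau_0)$ with $(\epsilon_0,\epsilon_1,\epsilon_2,\epsilon_3)=(+,+,-,-)$. *)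

theory Defs
  imports "HOL-Analysis.Analysis" "HOL-Library.Landau_Symbols"
begin

text \<open>
  The sign functions live on \<open>[0, 2^n \<tau>)\<close> and \<open>[0, 4^n \<tau>)\<close> respectively; the values
  that the total functions below take outside these intervals are irrelevant.
\<close>

primrec sign_z :: "real \<Rightarrow> nat \<Rightarrow> real \<Rightarrow> real" where
  "sign_z \<tau> 0 t = 1"
| "sign_z \<tau> (Suc n) t =
     (if t < 2 ^ n * \<tau> then sign_z \<tau> n t else - sign_z \<tau> n (t - 2 ^ n * \<tau>))"

primrec sign_x :: "real \<Rightarrow> nat \<Rightarrow> real \<Rightarrow> real" where
  "sign_x \<tau> 0 t = 1"
| "sign_x \<tau> (Suc n) t =
     (if t < 4 ^ n * \<tau> then sign_x \<tau> n t
      else if t < 2 * 4 ^ n * \<tau> then sign_x \<tau> n (t - 4 ^ n * \<tau>)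
      else if t < 3 * 4 ^ n * \<tau> then - sign_x \<tau> n (t - 2 * 4 ^ n * \<tau>)
      else - sign_x \<tau> n (t - 3 * 4 ^ n * \<tau>))"

definition finite_fourier :: "real \<Rightarrow> (real \<Rightarrow> real) \<Rightarrow> real \<Rightarrow> complex" where
  "finite_fourier T F \<omega> =
     integral {0..T} (\<lambda>t. exp (- (\<i> * of_real (\<omega> * t))) * of_real (F t))"

definition ft_z :: "real \<Rightarrow> nat \<Rightarrow> real \<Rightarrow> complex" where
  "ft_z \<tau> n = finite_fourier (2 ^ n * \<tau>) (sign_z \<tau> n)"

definition ft_x :: "real \<Rightarrow> nat \<Rightarrow> real \<Rightarrow> complex" where
  "ft_x \<tau> n = finite_fourier (4 ^ n * \<tau>) (sign_x \<tau> n)"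

text \<open>\<open>x_pow \<tau> \<omega> a\<close> is \<open>x^a\<close> for \<open>x = exp (-\<i>\<omega>\<tau>)\<close>, without choosing a branch of the power.\<close>

definition x_pow :: "real \<Rightarrow> real \<Rightarrow> real \<Rightarrow> complex" where
  "x_pow \<tau> \<omega> a = exp (- (\<i> * of_real (a * \<omega> * \<tau>)))"

text \<open>
  The limit \<open>\<omega>\<tau> \<rightarrow> 0\<close> (\<open>\<omega>\<tau> \<noteq> 0\<close>) over pairs \<open>(\<tau>, \<omega>)\<close> with \<open>\<tau> > 0\<close>. Only the product has to
  become small, so the implied constants do not depend on \<open>\<tau>\<close>; for a fixed \<open>\<tau>\<close> this
  specializes to \<open>\<omega> \<rightarrow> 0\<close>.
\<close>

definition small_phase :: "(real \<times> real) filter" where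
  "small_phase =
     inf (filtercomap (\<lambda>(\<tau>, \<omega>). \<omega> * \<tau>) (at 0)) (principal {(\<tau>, \<omega>). \<tau> > 0})"

lemma small_phase_fixed:
  assumes "\<tau> > 0"
  shows "filterlim (\<lambda>\<omega>. (\<tau>, \<omega>)) small_phase (at 0)"
proof -
  have "filterlim (\<lambda>\<omega>. \<omega> * \<tau>) (at 0) (at 0)"
  proof (rule filterlim_atI)
    show "((\<lambda>\<omega>. \<omega> * \<tau>) \<longlongrightarrow> 0) (at 0)"
      by (auto intro!: tendsto_eq_intros)
    show "\<forall>\<^sub>F \<omega> in at 0. \<omega> * \<tau> \<noteq> 0"
      using assms by (auto simp: eventually_at_filter)
  qed
  then show ?thesis
    using assms unfolding small_phase_def
    by (auto simp: filterlim_inf filterlim_principal filterlim_filtercomap_iff o_def)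
qed

end

theory Submission
  imports Defs
begin

text \<open>
  Level \<open>n + 1\<close> is a concatenation of shifted and signed copies of level \<open>n\<close>, and a shift by \<open>a\<close>
  multiplies the transform by \<open>exp (-\<i>\<omega>a)\<close>. With \<open>\<theta> = \<omega>\<tau>\<close> and \<open>y = exp (-\<i> 4^n \<theta>)\<close>, the transform
  therefore picks up the factor \<open>1 - exp (-\<i> 2^n \<theta>) \<sim> \<i> 2^n \<theta>\<close> in the first case and
  \<open>1 + y - y^2 - y^3 = (1 + y) (1 - y^2) \<sim> 4 \<i> 4^n \<theta>\<close> in the second. The transform
  at level \<open>0\<close> is \<open>\<tau>\<close> times a function of \<open>\<theta>\<close> alone tending to \<open>1\<close>, so leading terms multiply.
\<close>

section \<open>Exact transforms at every level\<close>

abbreviation cis_neg :: "real \<Rightarrow> complex" where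
  "cis_neg \<theta> \<equiv> exp (- (\<i> * of_real \<theta>))"

text \<open>Substituting \<open>t - a\<close> for the variable turns
  \<open>cis_neg (\<omega> * t)\<close> into the phase \<open>cis_neg (\<omega> * a)\<close> times
  the unshifted kernel. The relation between \<open>G\<close> and \<open>F\<close> is asked only on
  a half-open block, because at the right end of a block the recursion already uses the next branch;
  this single point is a null set.\<close>

lemma has_integral_fourier_shift:
  fixes F G :: "real \<Rightarrow> real"
  assumes F: "((\<lambda>t. cis_neg (\<omega> * t) * of_real (F t)) has_integral I) {0..T}"
    and G: "\<And>t. a \<le> t \<Longrightarrow> t < a + T \<Longrightarrow> G t = s * F (t - a)"
  shows "((\<lambda>t. cis_neg (\<omega> * t) * of_real (G t)) has_integral
           (of_real s * cis_neg (\<omega> * a) * I)) {a..a + T}"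
proof -
  have "((\<lambda>t. cis_neg (\<omega> * (t - a)) * of_real (F (t - a))) has_integral I) {a..a + T}"
    using has_integral_affinity[OF F[folded cbox_interval], of 1 "-a"]
    by (simp add: add.commute)
  then have "((\<lambda>t. of_real s * cis_neg (\<omega> * a) * (cis_neg (\<omega> * (t - a)) * of_real (F (t - a))))
      has_integral (of_real s * cis_neg (\<omega> * a) * I)) {a..a + T}"
    by (rule has_integral_mult_right)
  then show ?thesis
  proof (rule has_integral_spike_finite[rotated 2])
    show "finite {a + T}"
      by simp
    fix t assume "t \<in> {a..a + T} - {a + T}"
    then have "G t = s * F (t - a)"
      by (intro G) auto
    moreover have "cis_neg (\<omega> * t) = cis_neg (\<omega> * a) * cis_neg (\<omega> * (t - a))"
      by (simp add: exp_add[symmetric] algebra_simps)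
    ultimately show "cis_neg (\<omega> * t) * of_real (G t) =
        of_real s * cis_neg (\<omega> * a) * (cis_neg (\<omega> * (t - a)) * of_real (F (t - a)))"
      by simp
  qed
qed

text \<open>The level-0 transform divided by \<tau>, written in \<theta> = \<omega>\<tau> alone.
  Having no separate \<tau> is what later makes the error constants uniform in \<tau>. At \<theta> =
  0 the quotient takes the default value 0 instead of its limit 1, which the punctured filter
  \<open>at 0\<close> never sees.\<close>

definition base_transform :: "real \<Rightarrow> complex" where
  "base_transform \<theta> = (1 - cis_neg \<theta>) / (\<i> * of_real \<theta>)"

lemma has_integral_base:
  assumes "\<tau> > 0" "\<omega> \<noteq> 0"
  shows "((\<lambda>t. cis_neg (\<omega> * t)) has_integral (of_real \<tau> * base_transform (\<omega> * \<tau>))) {0..\<tau>}"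
proof -
  have "((\<lambda>t. cis_neg (\<omega> * t)) has_integral
      (- cis_neg (\<omega> * \<tau>) / (\<i> * of_real \<omega>) - - cis_neg (\<omega> * 0) / (\<i> * of_real \<omega>))) {0..\<tau>}"
  proof (rule fundamental_theorem_of_calculus)
    fix t
    \<comment> \<open>The antiderivative is differentiated as a function of a complex variable and
      then restricted to the real line.\<close>
    have "((\<lambda>z. - exp (- (\<i> * (of_real \<omega> * z))) / (\<i> * of_real \<omega>)) has_field_derivative
        exp (- (\<i> * (of_real \<omega> * of_real t)))) (at (of_real t))"
      using assms by (auto intro!: derivative_eq_intros simp: field_simps)
    from has_vector_derivative_real_field[OF this]
    show "((\<lambda>t. - cis_neg (\<omega> * t) / (\<i> * of_real \<omega>)) has_vector_derivative cis_neg (\<omega> * t))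
        (at t within {0..\<tau>})"
      by simp
  qed (use assms in simp)
  moreover have "- cis_neg (\<omega> * \<tau>) / (\<i> * of_real \<omega>) - - cis_neg (\<omega> * 0) / (\<i> * of_real \<omega>) =
      of_real \<tau> * base_transform (\<omega> * \<tau>)"
    using assms by (simp add: base_transform_def divide_simps)
  ultimately show ?thesis
    by simp
qed

lemma has_integral_sign_z:
  assumes "\<tau> > 0" "\<omega> \<noteq> 0"
  shows "((\<lambda>t. cis_neg (\<omega> * t) * of_real (sign_z \<tau> n t)) has_integral
           (of_real \<tau> * (base_transform (\<omega> * \<tau>) * (\<Prod>k<n. 1 - cis_neg (2 ^ k * (\<omega> * \<tau>))))))
         {0..2 ^ n * \<tau>}"
proof (induction n)
  case 0
  then show ?case
    using has_integral_base[OF assms] by simp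
next
  case (Suc n)
  define T where "T = 2 ^ n * \<tau>"
  define I where
    "I = of_real \<tau> * (base_transform (\<omega> * \<tau>) * (\<Prod>k<n. 1 - cis_neg (2 ^ k * (\<omega> * \<tau>))))"
  have T: "T > 0"
    using assms by (simp add: T_def)
  note shift = has_integral_fourier_shift[OF Suc.IH[folded T_def I_def], where G = "sign_z \<tau> (Suc n)"]
  \<comment> \<open>One unfolding of the recursion, phrased with \<open>T\<close>, so that
    comparisons of \<open>t\<close> with \<open>T\<close> select the branch on each block.\<close>
  have sign: "sign_z \<tau> (Suc n) t = (if t < T then sign_z \<tau> n t else - sign_z \<tau> n (t - T))" for t
    by (simp add: T_def)
  let ?int = "\<lambda>J. ((\<lambda>t. cis_neg (\<omega> * t) * of_real (sign_z \<tau> (Suc n) t)) has_integral J)"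
  have "?int (of_real 1 * cis_neg (\<omega> * 0) * I) {0..T}"
    using T shift[of 0 1] by (simp add: sign del: sign_z.simps)
  moreover have "?int (of_real (-1) * cis_neg (\<omega> * T) * I) {T..2 * T}"
    using T shift[of T "-1"] by (simp add: sign del: sign_z.simps)
  ultimately have
    "?int (of_real 1 * cis_neg (\<omega> * 0) * I + of_real (-1) * cis_neg (\<omega> * T) * I) {0..2 * T}"
    using T by (intro has_integral_combine[of 0 T "2 * T"]) simp_all
  moreover have "of_real 1 * cis_neg (\<omega> * 0) * I + of_real (-1) * cis_neg (\<omega> * T) * I =
      I * (1 - cis_neg (2 ^ n * (\<omega> * \<tau>)))"
    by (simp add: T_def algebra_simps)
  moreover have "2 ^ Suc n * \<tau> = 2 * T"
    by (simp add: T_def)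
  ultimately show ?case
    by (simp only: prod.lessThan_Suc mult.assoc I_def)
qed

lemma has_integral_sign_x:
  assumes "\<tau> > 0" "\<omega> \<noteq> 0"
  shows "((\<lambda>t. cis_neg (\<omega> * t) * of_real (sign_x \<tau> n t)) has_integral
           (of_real \<tau> * (base_transform (\<omega> * \<tau>) *
             (\<Prod>k<n. (1 + cis_neg (4 ^ k * (\<omega> * \<tau>))) * (1 - cis_neg (2 * 4 ^ k * (\<omega> * \<tau>)))))))
         {0..4 ^ n * \<tau>}"
proof (induction n)
  case 0
  then show ?case
    using has_integral_base[OF assms] by simp
next
  case (Suc n)
  define T where "T = 4 ^ n * \<tau>"
  define I where "I = of_real \<tau> * (base_transform (\<omega> * \<tau>) *
    (\<Prod>k<n. (1 + cis_neg (4 ^ k * (\<omega> * \<tau>))) * (1 - cis_neg (2 * 4 ^ k * (\<omega> * \<tau>)))))"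
  have T: "T > 0"
    using assms by (simp add: T_def)
  note shift = has_integral_fourier_shift[OF Suc.IH[folded T_def I_def], where G = "sign_x \<tau> (Suc n)"]
  have sign: "sign_x \<tau> (Suc n) t =
      (if t < T then sign_x \<tau> n t
       else if t < 2 * T then sign_x \<tau> n (t - T)
       else if t < 3 * T then - sign_x \<tau> n (t - 2 * T)
       else - sign_x \<tau> n (t - 3 * T))" for t
    by (simp add: T_def mult.assoc)
  let ?int = "\<lambda>J. ((\<lambda>t. cis_neg (\<omega> * t) * of_real (sign_x \<tau> (Suc n) t)) has_integral J)"
  have "?int (of_real 1 * cis_neg (\<omega> * 0) * I) {0..T}"
    using T shift[of 0 1] by (simp add: sign del: sign_x.simps)
  moreover have "?int (of_real 1 * cis_neg (\<omega> * T) * I) {T..2 * T}"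
    using T shift[of T 1] by (simp add: sign del: sign_x.simps)
  moreover have "?int (of_real (-1) * cis_neg (\<omega> * (2 * T)) * I) {2 * T..3 * T}"
    using T shift[of "2 * T" "-1"] by (simp add: sign del: sign_x.simps)
  moreover have "?int (of_real (-1) * cis_neg (\<omega> * (3 * T)) * I) {3 * T..4 * T}"
    using T shift[of "3 * T" "-1"] by (simp add: sign del: sign_x.simps)
  ultimately have "?int (of_real 1 * cis_neg (\<omega> * 0) * I + of_real 1 * cis_neg (\<omega> * T) * I +
       of_real (-1) * cis_neg (\<omega> * (2 * T)) * I + of_real (-1) * cis_neg (\<omega> * (3 * T)) * I) {0..4 * T}"
    using T by (intro has_integral_combine[of 0 "3 * T" "4 * T"]
        has_integral_combine[of 0 "2 * T" "3 * T"] has_integral_combine[of 0 T "2 * T"]) simp_all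
  moreover have "of_real 1 * cis_neg (\<omega> * 0) * I + of_real 1 * cis_neg (\<omega> * T) * I +
      of_real (-1) * cis_neg (\<omega> * (2 * T)) * I + of_real (-1) * cis_neg (\<omega> * (3 * T)) * I =
      I * ((1 + cis_neg (4 ^ n * (\<omega> * \<tau>))) * (1 - cis_neg (2 * 4 ^ n * (\<omega> * \<tau>))))"
  proof -
    \<comment> \<open>With y = \<open>cis_neg (\<omega> * T)\<close> and y^2 =
      \<open>cis_neg (\<omega> * (2 * T))\<close> kept as separate atoms, y^3 = y * y^2 is the only
      relation needed to factor the sum 1 + y - y^2 - y^3.\<close>
    have "cis_neg (\<omega> * (3 * T)) = cis_neg (\<omega> * T) * cis_neg (\<omega> * (2 * T))"
      by (simp add: exp_add[symmetric] algebra_simps)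
    moreover have "4 ^ n * (\<omega> * \<tau>) = \<omega> * T" "2 * 4 ^ n * (\<omega> * \<tau>) = \<omega> * (2 * T)"
      by (simp_all add: T_def)
    ultimately show ?thesis
      by (simp only:) (simp add: algebra_simps)
  qed
  moreover have "4 ^ Suc n * \<tau> = 4 * T"
    by (simp add: T_def)
  ultimately show ?case
    by (simp only: prod.lessThan_Suc mult.assoc I_def)
qed

lemma ft_z_eq:
  assumes "\<tau> > 0" "\<omega> \<noteq> 0"
  shows "ft_z \<tau> n \<omega> =
    of_real \<tau> * (base_transform (\<omega> * \<tau>) * (\<Prod>k<n. 1 - cis_neg (2 ^ k * (\<omega> * \<tau>))))"
  unfolding ft_z_def finite_fourier_def
  by (rule integral_unique[OF has_integral_sign_z[OF assms]])

lemma ft_x_eq: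
  assumes "\<tau> > 0" "\<omega> \<noteq> 0"
  shows "ft_x \<tau> n \<omega> = of_real \<tau> * (base_transform (\<omega> * \<tau>) *
    (\<Prod>k<n. (1 + cis_neg (4 ^ k * (\<omega> * \<tau>))) * (1 - cis_neg (2 * 4 ^ k * (\<omega> * \<tau>)))))"
  unfolding ft_x_def finite_fourier_def
  by (rule integral_unique[OF has_integral_sign_x[OF assms]])

section \<open>Closed form with sines\<close>

text \<open>Pulling out the half phase leaves a difference of conjugate exponentials, which is a
  sine.\<close>

lemma one_minus_cis_neg: "1 - cis_neg \<theta> = cis_neg (\<theta> / 2) * (2 * \<i> * of_real (sin (\<theta> / 2)))"
proof -
  have "2 * \<i> * of_real (sin (\<theta> / 2)) = exp (\<i> * of_real (\<theta> / 2)) - cis_neg (\<theta> / 2)"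
    by (simp add: sin_of_real[symmetric] sin_exp_eq)
  then have "cis_neg (\<theta> / 2) * (2 * \<i> * of_real (sin (\<theta> / 2))) =
      cis_neg (\<theta> / 2) * exp (\<i> * of_real (\<theta> / 2)) - cis_neg (\<theta> / 2) * cis_neg (\<theta> / 2)"
    by (simp only: right_diff_distrib)
  also have "\<dots> = 1 - cis_neg \<theta>"
    by (simp add: exp_add[symmetric] field_simps)
  finally show ?thesis ..
qed

lemma ft_z_closed_form:
  assumes "\<tau> > 0" "\<omega> \<noteq> 0"
  shows "ft_z \<tau> n \<omega> =
    2 * of_real (inverse \<omega>) * x_pow \<tau> \<omega> (1 / 2) * of_real (sin (\<omega> * \<tau> / 2)) *
    (\<Prod>k = 1..n. x_pow \<tau> \<omega> (2 powi (int k - 2)) *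
      (2 * \<i> * of_real (sin (2 powi (int k - 2) * \<omega> * \<tau>))))"
proof -
  \<comment> \<open>The half-phase identity at \<theta> = \<omega>\<tau> supplies the prefactor:
    \<tau> / (\<i> \<theta>) = 1 / (\<i> \<omega>), and the \<i> cancels against the one in front of
    the sine.\<close>
  have "of_real \<tau> * base_transform (\<omega> * \<tau>) =
      2 * of_real (inverse \<omega>) * x_pow \<tau> \<omega> (1 / 2) * of_real (sin (\<omega> * \<tau> / 2))"
    unfolding base_transform_def one_minus_cis_neg using assms
    by (simp add: x_pow_def field_simps)
  moreover have "(\<Prod>k<n. 1 - cis_neg (2 ^ k * (\<omega> * \<tau>))) =
      (\<Prod>k = 1..n. x_pow \<tau> \<omega> (2 powi (int k - 2)) *
        (2 * \<i> * of_real (sin (2 powi (int k - 2) * \<omega> * \<tau>))))"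
  proof (rule prod.reindex_bij_witness[of _ "\<lambda>k. k - 1" Suc])
    fix k
    \<comment> \<open>Factor \<open>k\<close> counted from 0 is factor \<open>Suc k\<close> counted
      from 1, and its half phase has exponent \<open>k - 1\<close>. This is -1 for the first factor,
      hence the integer power.\<close>
    have "2 powi (int (Suc k) - 2) = (2 ^ k / 2 :: real)"
      using power_int_diff[of "2::real" "int k" 1] by simp
    moreover have "2 ^ k / 2 * \<omega> * \<tau> = 2 ^ k * (\<omega> * \<tau>) / 2"
      by simp
    ultimately show "x_pow \<tau> \<omega> (2 powi (int (Suc k) - 2)) *
        (2 * \<i> * of_real (sin (2 powi (int (Suc k) - 2) * \<omega> * \<tau>))) = 1 - cis_neg (2 ^ k * (\<omega> * \<tau>))"
      by (simp only: one_minus_cis_neg x_pow_def)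
  qed auto
  ultimately show ?thesis
    by (simp add: ft_z_eq[OF assms] mult.assoc[symmetric])
qed

section \<open>Calculus of leading terms\<close>

text \<open>Encodes an expansion c \<theta>^m + ... with remainder one order higher, the form in
  which the coefficient and the order can be multiplied out factor by factor.\<close>

definition leading_term :: "(real \<Rightarrow> complex) \<Rightarrow> complex \<Rightarrow> nat \<Rightarrow> bool" where
  "leading_term f c m \<longleftrightarrow>
     (\<lambda>\<theta>. f \<theta> - c * of_real \<theta> ^ m) \<in> O[at 0](\<lambda>\<theta>. of_real \<theta> ^ (m + 1))"

lemma leading_termI:
  assumes "\<And>\<theta>. \<theta> \<noteq> 0 \<Longrightarrow> norm (f \<theta> - c * of_real \<theta> ^ m) \<le> C * \<bar>\<theta>\<bar> ^ (m + 1)"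
  shows "leading_term f c m"
  unfolding leading_term_def using assms
  by (intro bigoI[of _ C]) (auto simp: eventually_at_filter norm_mult norm_power)

text \<open>The error of the product splits as (f - c \<theta>^m) g + c \<theta>^m (g - d
  \<theta>^l). The second summand is small by assumption; for the first, g = O(\<theta>^l) is
  enough.\<close>

lemma leading_term_mult:
  assumes f: "leading_term f c m" and g: "leading_term g d l"
  shows "leading_term (\<lambda>\<theta>. f \<theta> * g \<theta>) (c * d) (m + l)"
proof -
  \<comment> \<open>Near 0, where |\<theta>| < 1, a higher power is dominated by a lower one; this
    turns the remainder bound on g into g = O(\<theta>^l).\<close>
  have pow: "(\<lambda>\<theta>. of_real \<theta> ^ (p + q)) \<in> O[at 0](\<lambda>\<theta>. of_real \<theta> ^ p :: complex)" for p q
  proof (rule bigoI[of _ 1])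
    have "eventually (\<lambda>\<theta>::real. \<bar>\<theta>\<bar> < 1) (at 0)"
      using eventually_at[of "\<lambda>\<theta>::real. \<bar>\<theta>\<bar> < 1" 0 UNIV]
      by (auto simp: dist_real_def intro!: exI[of _ 1])
    then show "eventually (\<lambda>\<theta>.
        norm (of_real \<theta> ^ (p + q) :: complex) \<le> 1 * norm (of_real \<theta> ^ p :: complex)) (at 0)"
      by eventually_elim (simp add: norm_mult norm_power power_add power_le_one mult_left_le)
  qed
  have "(\<lambda>\<theta>. g \<theta> - d * of_real \<theta> ^ l) \<in> O[at 0](\<lambda>\<theta>. of_real \<theta> ^ l)"
    using g[unfolded leading_term_def] pow by (rule landau_o.big_trans)
  then have "(\<lambda>\<theta>. (g \<theta> - d * of_real \<theta> ^ l) + d * of_real \<theta> ^ l) \<in> O[at 0](\<lambda>\<theta>. of_real \<theta> ^ l)"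
    by (rule sum_in_bigo) simp
  then have "(\<lambda>\<theta>. (f \<theta> - c * of_real \<theta> ^ m) * g \<theta>) \<in> O[at 0](\<lambda>\<theta>. of_real \<theta> ^ (m + 1) * of_real \<theta> ^ l)"
    using f[unfolded leading_term_def] by (intro landau_o.big_mult) simp_all
  moreover have "(\<lambda>\<theta>. (c * of_real \<theta> ^ m) * (g \<theta> - d * of_real \<theta> ^ l)) \<in>
      O[at 0](\<lambda>\<theta>. of_real \<theta> ^ m * of_real \<theta> ^ (l + 1))"
    using g[unfolded leading_term_def] by (intro landau_o.big_mult) simp_all
  ultimately have "(\<lambda>\<theta>. (f \<theta> - c * of_real \<theta> ^ m) * g \<theta> + (c * of_real \<theta> ^ m) * (g \<theta> - d * of_real \<theta> ^ l))
      \<in> O[at 0](\<lambda>\<theta>. of_real \<theta> ^ (m + l + 1))"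
    by (intro sum_in_bigo) (simp_all add: power_add mult_ac)
  then show ?thesis
    by (simp add: leading_term_def algebra_simps power_add)
qed

text \<open>Each of the \<open>n\<close> factors contributes exactly one order and the base
  contributes none, so the order of the whole product is the level \<open>n\<close>.\<close>

lemma leading_term_prod:
  assumes "leading_term f c 0" and "\<And>k. leading_term (g k) (d k) 1"
  shows "leading_term (\<lambda>\<theta>. f \<theta> * (\<Prod>k<n. g k \<theta>)) (c * (\<Prod>k<n. d k)) n"
proof (induction n)
  case 0
  then show ?case
    using assms(1) by simp
next
  case (Suc n)
  then show ?case
    using leading_term_mult[OF Suc.IH assms(2)[of n]] by (simp add: mult.assoc)
qed

section \<open>Leading terms of the individual factors\<close>

text \<open>Taylor remainder of exp after the linear term. The argument is purely imaginary, so the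
  growth factor exp |Re z| in the remainder is 1 and the bound holds for all real \<theta>.\<close>

lemma norm_cis_neg_minus_linear: "norm (cis_neg \<theta> - 1 + \<i> * of_real \<theta>) \<le> \<bar>\<theta>\<bar> ^ 2"
  using Taylor_exp[of "- (\<i> * of_real \<theta>)" 1]
  by (simp add: norm_mult diff_diff_eq power2_eq_square algebra_simps)

lemma leading_term_base: "leading_term base_transform 1 0"
proof (rule leading_termI)
  fix \<theta> :: real assume "\<theta> \<noteq> 0"
  then have "base_transform \<theta> - 1 * of_real \<theta> ^ 0 =
      - ((cis_neg \<theta> - 1 + \<i> * of_real \<theta>) / (\<i> * of_real \<theta>))"
    by (simp add: base_transform_def field_simps)
  then have "norm (base_transform \<theta> - 1 * of_real \<theta> ^ 0) =
      norm (cis_neg \<theta> - 1 + \<i> * of_real \<theta>) / \<bar>\<theta>\<bar>"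
    by (simp only: norm_minus_cancel norm_divide norm_mult norm_ii norm_of_real mult_1)
  also have "\<dots> \<le> 1 * \<bar>\<theta>\<bar> ^ (0 + 1)"
    using norm_cis_neg_minus_linear[of \<theta>] \<open>\<theta> \<noteq> 0\<close> by (simp add: field_simps power2_eq_square)
  finally show "norm (base_transform \<theta> - 1 * of_real \<theta> ^ 0) \<le> 1 * \<bar>\<theta>\<bar> ^ (0 + 1)" .
qed

lemma leading_term_one_minus_cis_neg:
  "leading_term (\<lambda>\<theta>. 1 - cis_neg (a * \<theta>)) (\<i> * of_real a) 1"
proof (rule leading_termI)
  fix \<theta> :: real
  have "1 - cis_neg (a * \<theta>) - \<i> * of_real a * of_real \<theta> ^ 1 =
      - (cis_neg (a * \<theta>) - 1 + \<i> * of_real (a * \<theta>))"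
    by simp
  moreover have "a\<^sup>2 * \<bar>\<theta>\<bar> ^ (1 + 1) = \<bar>a * \<theta>\<bar>\<^sup>2"
    by (simp add: power2_eq_square mult_ac)
  ultimately show "norm (1 - cis_neg (a * \<theta>) - \<i> * of_real a * of_real \<theta> ^ 1) \<le> a\<^sup>2 * \<bar>\<theta>\<bar> ^ (1 + 1)"
    using norm_cis_neg_minus_linear[of "a * \<theta>"]
    by (simp only: norm_minus_cancel)
qed

lemma leading_term_one_plus_cis_neg: "leading_term (\<lambda>\<theta>. 1 + cis_neg (a * \<theta>)) 2 0"
proof (rule leading_termI)
  fix \<theta> :: real
  have "1 + cis_neg (a * \<theta>) - 2 * of_real \<theta> ^ 0 = cis_neg (a * \<theta>) - 1"
    by simp
  \<comment> \<open>The same remainder estimate, now cut off after the constant term.\<close>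
  then show "norm (1 + cis_neg (a * \<theta>) - 2 * of_real \<theta> ^ 0) \<le> \<bar>a\<bar> * \<bar>\<theta>\<bar> ^ (0 + 1)"
    using Taylor_exp[of "- (\<i> * of_real (a * \<theta>))" 0]
    by (simp only:) (simp add: norm_mult)
qed

section \<open>Passage to the limit in \<omega>\<tau>\<close>

text \<open>The factor \<tau> stands in both the error and the bound, and the rest is a one-variable
  estimate composed with the map from (\<tau>, \<omega>) to \<omega>\<tau>. Hence one constant
  serves all \<tau> > 0.\<close>

lemma bigo_small_phase:
  assumes lead: "leading_term g c n"
    and f: "\<And>\<tau> \<omega>. \<tau> > 0 \<Longrightarrow> \<omega> \<noteq> 0 \<Longrightarrow> f \<tau> \<omega> = of_real \<tau> * g (\<omega> * \<tau>)"
  shows "(\<lambda>(\<tau>, \<omega>). f \<tau> \<omega> - of_real \<tau> * c * of_real (\<omega> * \<tau>) ^ n)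
           \<in> O[small_phase](\<lambda>(\<tau>, \<omega>). of_real \<tau> * of_real (\<omega> * \<tau>) ^ (n + 1))"
proof -
  have lim: "filterlim (\<lambda>(\<tau>, \<omega>). \<omega> * \<tau>) (at 0) small_phase"
    unfolding small_phase_def
    by (rule filterlim_mono[OF filterlim_filtercomap order_refl inf_le1])
  have big: "(\<lambda>p. of_real (fst p) * (g ((\<lambda>(\<tau>, \<omega>). \<omega> * \<tau>) p) - c * of_real ((\<lambda>(\<tau>, \<omega>). \<omega> * \<tau>) p) ^ n))
      \<in> O[small_phase](\<lambda>p. of_real (fst p) * of_real ((\<lambda>(\<tau>, \<omega>). \<omega> * \<tau>) p) ^ (n + 1))"
    using landau_o.big.compose[OF lead[unfolded leading_term_def] lim]
    by (intro landau_o.big_mult) simp_all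
  \<comment> \<open>The formula for \<open>f\<close> holds only for \<tau> > 0 and \<omega> \<noteq>
    0; both hold eventually, the latter because \<omega>\<tau> \<noteq> 0.\<close>
  have "eventually (\<lambda>(\<tau>, \<omega>). \<tau> > 0) small_phase"
    unfolding small_phase_def eventually_inf_principal by simp
  moreover have "eventually (\<lambda>p. (\<lambda>(\<tau>, \<omega>). \<omega> * \<tau>) p \<noteq> 0) small_phase"
    using lim by (simp add: filterlim_at)
  ultimately have "eventually (\<lambda>p. of_real (fst p) *
      (g ((\<lambda>(\<tau>, \<omega>). \<omega> * \<tau>) p) - c * of_real ((\<lambda>(\<tau>, \<omega>). \<omega> * \<tau>) p) ^ n) =
      (\<lambda>(\<tau>, \<omega>). f \<tau> \<omega> - of_real \<tau> * c * of_real (\<omega> * \<tau>) ^ n) p) small_phase"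
    by eventually_elim (auto simp: f algebra_simps)
  with big show ?thesis
    by (simp add: landau_o.big.in_cong case_prod_unfold)
qed

theorem mainTheorem8:
  fixes n :: nat
  assumes "n \<ge> 1"
  shows "(\<forall>\<tau> \<omega> :: real. \<tau> > 0 \<longrightarrow> \<omega> \<noteq> 0 \<longrightarrow>
           ft_z \<tau> n \<omega> =
             2 * of_real (inverse \<omega>) * x_pow \<tau> \<omega> (1 / 2) * of_real (sin (\<omega> * \<tau> / 2)) *
             (\<Prod>k = 1..n. x_pow \<tau> \<omega> (2 powi (int k - 2)) *
                (2 * \<i> * of_real (sin (2 powi (int k - 2) * \<omega> * \<tau>)))))
    \<and> (\<lambda>(\<tau>, \<omega>). ft_z \<tau> n \<omega> -
             of_real \<tau> * \<i> ^ n * 2 ^ (n * (n - 1) div 2) * of_real (\<omega> * \<tau>) ^ n)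
           \<in> O[small_phase](\<lambda>(\<tau>, \<omega>). of_real \<tau> * of_real (\<omega> * \<tau>) ^ (n + 1))
    \<and> (\<lambda>(\<tau>, \<omega>). ft_x \<tau> n \<omega> -
             of_real \<tau> * \<i> ^ n * 4 ^ (n * (n + 1) div 2) * of_real (\<omega> * \<tau>) ^ n)
           \<in> O[small_phase](\<lambda>(\<tau>, \<omega>). of_real \<tau> * of_real (\<omega> * \<tau>) ^ (n + 1))"
proof (intro conjI allI impI)
  fix \<tau> \<omega> :: real assume "\<tau> > 0" "\<omega> \<noteq> 0"
  then show "ft_z \<tau> n \<omega> =
      2 * of_real (inverse \<omega>) * x_pow \<tau> \<omega> (1 / 2) * of_real (sin (\<omega> * \<tau> / 2)) *
      (\<Prod>k = 1..n. x_pow \<tau> \<omega> (2 powi (int k - 2)) *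
         (2 * \<i> * of_real (sin (2 powi (int k - 2) * \<omega> * \<tau>))))"
    by (rule ft_z_closed_form)
next
  \<comment> \<open>The exponents 0, ..., n - 1 of 2 add up to n(n - 1)/2.\<close>
  have coeff: "1 * (\<Prod>k<n. \<i> * of_real (2 ^ k)) = \<i> ^ n * 2 ^ (n * (n - 1) div 2)"
    by (simp add: prod.distrib power_sum[symmetric] Sum_Ico_nat atLeast0LessThan[symmetric])
  \<comment> \<open>The scale \<open>a\<close> in the factor may depend on the index
    \<open>k\<close>; here it is 2^k.\<close>
  note lead = leading_term_prod[OF leading_term_base leading_term_one_minus_cis_neg, where n = n,
      of "\<lambda>k. 2 ^ k", unfolded coeff]
  show "(\<lambda>(\<tau>, \<omega>). ft_z \<tau> n \<omega> -
             of_real \<tau> * \<i> ^ n * 2 ^ (n * (n - 1) div 2) * of_real (\<omega> * \<tau>) ^ n)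
           \<in> O[small_phase](\<lambda>(\<tau>, \<omega>). of_real \<tau> * of_real (\<omega> * \<tau>) ^ (n + 1))"
    by (rule bigo_small_phase[OF lead, folded mult.assoc]) (rule ft_z_eq[folded mult.assoc])
next
  have coeff: "1 * (\<Prod>k<n. 2 * (\<i> * of_real (2 * 4 ^ k))) = \<i> ^ n * (4 :: complex) ^ (n * (n + 1) div 2)"
  proof -
    \<comment> \<open>The 2 from 1 + y and the 2 from 1 - y^2 together raise 4^k to 4^(k+1). The
      exponents therefore run over 1, ..., n, which gives n(n + 1)/2.\<close>
    have "(\<Prod>k<n. 2 * (\<i> * of_real (2 * 4 ^ k))) = (\<Prod>k<n. \<i> * (4 :: complex) ^ Suc k)"
      by (intro prod.cong) simp_all
    also have "\<dots> = \<i> ^ n * 4 ^ (\<Sum>k<n. Suc k)"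
      by (simp add: prod.distrib power_sum del: power_Suc)
    also have "(\<Sum>k<n. Suc k) = n * (n + 1) div 2"
      by (induction n) auto
    finally show ?thesis
      by simp
  qed
  have "leading_term (\<lambda>\<theta>. (1 + cis_neg (4 ^ k * \<theta>)) * (1 - cis_neg (2 * 4 ^ k * \<theta>)))
      (2 * (\<i> * of_real (2 * 4 ^ k))) 1" for k
    using leading_term_mult[OF leading_term_one_plus_cis_neg[of "4 ^ k"]
        leading_term_one_minus_cis_neg[of "2 * 4 ^ k"]]
    by (simp only: add_0)
  note lead = leading_term_prod[OF leading_term_base this, where n = n, of "\<lambda>k. k", unfolded coeff]
  show "(\<lambda>(\<tau>, \<omega>). ft_x \<tau> n \<omega> -
             of_real \<tau> * \<i> ^ n * 4 ^ (n * (n + 1) div 2) * of_real (\<omega> * \<tau>) ^ n)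
           \<in> O[small_phase](\<lambda>(\<tau>, \<omega>). of_real \<tau> * of_real (\<omega> * \<tau>) ^ (n + 1))"
    by (rule bigo_small_phase[OF lead, folded mult.assoc]) (rule ft_x_eq[folded mult.assoc])
qed

end
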